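(* Let $t$ be a positive integer and let $P_n$ be the path on $n$ vertices with $n\ge 3$. Then $c\chi_2^t(P_n)=4$ if $t=1$, and $c\chi_2^t(P_n)=2$ if $t\ge 2$.
   Context: Graphs are finite, undirected and simple. For a positive integer $k$ and $i,j\in\{0,1,\dots,k-1\}$, the circular distance is $|i-j|_k=\min\{|i-j|,\,k-|i-j|\}$. For a nonnegative integer $t$, a $(\frac{k}{2},t)^*$-coloring of a graph $G$ is a mapping $f:V(G)\to\{0,1,\dots,k-1\}$ such that adjacent vertices receive different integers and, for each vertex $u$, the number of neighbors $v$ of $u$ with $|f(u)-f(v)|_k=1$ is at most $t$. $G$ is $(\frac{k}{2},t)^*$-colorable if it has such a coloring. (The symbol $\frac{k}{2}$ is formal notation recording the pair $(k,2)$, not a reduced fraction.) The $t$-relaxed 2-distant circular chromatic number $c\chi_2^t(G)$ is the minimum positive integer $k$ such that $G$ is $(\frac{k}{2},t)^*$-colorable. *)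

theory Defs
  imports "HOL-Library.FuncSet" "Graph_Theory.Pair_Digraph"
begin

text \<open>
  A finite simple undirected graph is a \<open>pair_graph\<close>: each edge \<open>uv\<close> is the pair of
  arcs \<open>(u, v)\<close> and \<open>(v, u)\<close>, so the neighbours of \<open>u\<close> are the \<open>v\<close> with \<open>(u, v) \<in> parcs G\<close>.
\<close>

text \<open>Integer-valued, to avoid truncated subtraction.\<close>

definition circ_dist :: "nat \<Rightarrow> nat \<Rightarrow> nat \<Rightarrow> int" where
  "circ_dist k i j = min \<bar>int i - int j\<bar> (int k - \<bar>int i - int j\<bar>)"

text \<open>
  A \<open>(k/2, t)\<^sup>*\<close>-colouring; \<open>k/2\<close> is formal notation, so only \<open>k\<close> is a parameter.
  The values of \<open>f\<close> outside \<open>pverts G\<close> are irrelevant.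
\<close>

definition half_coloring :: "nat \<Rightarrow> nat \<Rightarrow> 'a pair_pre_digraph \<Rightarrow> ('a \<Rightarrow> nat) \<Rightarrow> bool" where
  "half_coloring k t G f \<longleftrightarrow>
     f \<in> pverts G \<rightarrow> {0..<k} \<and>
     (\<forall>u v. (u, v) \<in> parcs G \<longrightarrow> f u \<noteq> f v) \<and>
     (\<forall>u \<in> pverts G. card {v. (u, v) \<in> parcs G \<and> circ_dist k (f u) (f v) = 1} \<le> t)"

definition half_colorable :: "nat \<Rightarrow> nat \<Rightarrow> 'a pair_pre_digraph \<Rightarrow> bool" where
  "half_colorable k t G \<longleftrightarrow> (\<exists>f. half_coloring k t G f)"

text \<open>The minimum is attained for every \<open>pair_graph\<close>, see \<open>ex_half_colorable\<close> below.\<close>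

definition circ_chromatic2 :: "nat \<Rightarrow> 'a pair_pre_digraph \<Rightarrow> nat" where
  "circ_chromatic2 t G = (LEAST k. k > 0 \<and> half_colorable k t G)"

definition path_graph :: "nat \<Rightarrow> nat pair_pre_digraph" where
  "path_graph n = \<lparr> pverts = {0..<n},
     parcs = {(i, j). i < n \<and> j < n \<and> (j = Suc i \<or> i = Suc j)} \<rparr>"

lemma pair_graph_path_graph: "pair_graph (path_graph n)"
proof -
  have "finite (parcs (path_graph n))"
    by (rule finite_subset[of _ "{0..<n} \<times> {0..<n}"]) (auto simp: path_graph_def)
  then show ?thesis
    by unfold_locales (auto simp: path_graph_def symmetric_def sym_def)
qed

lemma ex_half_colorable:
  assumes "pair_graph G"
  shows "\<exists>k > 0. half_colorable k t G"
proof -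
  interpret pair_graph G by fact
  obtain h where h: "bij_betw h (pverts G) {0..<card (pverts G)}"
    using ex_bij_betw_finite_nat[OF pair_finite_verts] by blast
  let ?k = "2 * card (pverts G) + 2"
  let ?f = "\<lambda>v. 2 * h v"
  have lt: "h v < card (pverts G)" if "v \<in> pverts G" for v
    using h that by (auto simp: bij_betw_def)
  have "h u \<noteq> h v" if "(u, v) \<in> parcs G" for u v
    using that h in_arcsD1[OF that] in_arcsD2[OF that] pair_no_loops[OF that]
    by (auto simp: bij_betw_def inj_on_def)
  moreover have "circ_dist ?k (?f u) (?f v) \<noteq> 1" for u v
    unfolding circ_dist_def min_def by presburger
  ultimately have "half_coloring ?k t G ?f"
    using lt by (fastforce simp: half_coloring_def)
  then show ?thesis
    unfolding half_colorable_def by (intro exI[of _ ?k]) auto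
qed

end

theory Submission
  imports Defs
begin

text \<open>
  For \<open>k \<le> 3\<close> any two distinct colours are at circular distance 1, so an inner vertex, having two
  neighbours, rules out \<open>t = 1\<close>. Alternating two colours gives the upper bounds: \<open>0, 1\<close> for
  \<open>k = 2\<close>, and the antipodal colours \<open>0, 2\<close> for \<open>k = 4\<close>.
\<close>

lemma circ_dist_eq_1:
  assumes "i < k" "j < k" "i \<noteq> j" "k \<le> 3"
  shows "circ_dist k i j = 1"
proof (cases "i < j")
  case True
  \<comment> \<open>A gap of 2 forces \<open>k = 3\<close>, where going round the other way gives
    distance 3 - 2 = 1. A gap of 1 leaves at least 1 on the other side, since \<open>k\<close> is at
    least 2.\<close>
  then have "j - i = 1 \<or> j - i = 2 \<and> k = 3"
    using assms by linarith
  then show ?thesis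
    using True assms by (auto simp: circ_dist_def)
next
  case False
  then have "i - j = 1 \<or> i - j = 2 \<and> k = 3"
    using assms by linarith
  then show ?thesis
    using False assms by (auto simp: circ_dist_def)
qed

text \<open>At the end vertices this is a strict inclusion. For \<open>u = 0\<close> the truncated
  \<open>u - 1\<close> is 0 itself, which is harmless because only an upper bound on the degree is
  wanted.\<close>

lemma neighbours_path_graph_subset: "{v. (u, v) \<in> parcs (path_graph n)} \<subseteq> {u - 1, Suc u}"
  by (auto simp: path_graph_def)

text \<open>Both colourings below depend only on the parity of the vertex, so this makes them
  proper.\<close>

lemma path_graph_arc_parity:
  assumes "(u, v) \<in> parcs (path_graph n)"
  shows "u mod 2 \<noteq> v mod 2"
proof -
  have "v = Suc u \<or> u = Suc v"
    using assms by (simp add: path_graph_def)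
  then show ?thesis
    by presburger
qed

lemma half_colorable_path_graph_4: "half_colorable 4 t (path_graph n)"
proof -
  let ?f = "\<lambda>i::nat. 2 * (i mod 2)"
  \<comment> \<open>The distance is 0 or 2, so no neighbour is ever counted and the bound holds for
    every \<open>t\<close>, even 0.\<close>
  have "circ_dist 4 (?f u) (?f v) \<noteq> 1" for u v
    by (cases "even u"; cases "even v") (simp_all add: circ_dist_def odd_iff_mod_2_eq_one)
  moreover have "?f u \<noteq> ?f v" if "(u, v) \<in> parcs (path_graph n)" for u v
    using path_graph_arc_parity[OF that] by simp
  moreover have "?f u < 4" for u
    using mod_less_divisor[of 2 u] by linarith
  ultimately have "half_coloring 4 t (path_graph n) ?f"
    by (simp add: half_coloring_def)
  then show ?thesis
    unfolding half_colorable_def by blast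
qed

lemma half_colorable_path_graph_2:
  assumes "t \<ge> 2"
  shows "half_colorable 2 t (path_graph n)"
proof -
  let ?f = "\<lambda>i::nat. i mod 2"
  have "card {v. (u, v) \<in> parcs (path_graph n) \<and> circ_dist 2 (?f u) (?f v) = 1} \<le> t" for u
  proof -
    \<comment> \<open>With two colours every edge has circular distance 1, so dropping the colour
      condition loses nothing: the count is the degree.\<close>
    have "card {v. (u, v) \<in> parcs (path_graph n) \<and> circ_dist 2 (?f u) (?f v) = 1}
        \<le> card {u - 1, Suc u}"
      using neighbours_path_graph_subset[of u n] by (intro card_mono) auto
    also have "\<dots> \<le> 2"
      by (simp add: card_insert_if)
    finally show ?thesis
      using assms by linarith
  qed
  moreover have "?f u \<noteq> ?f v" if "(u, v) \<in> parcs (path_graph n)" for u v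
    using path_graph_arc_parity[OF that] by simp
  ultimately have "half_coloring 2 t (path_graph n) ?f"
    by (simp add: half_coloring_def)
  then show ?thesis
    unfolding half_colorable_def by blast
qed

text \<open>The edge between 0 and 1 alone needs two colours, whatever \<open>t\<close> is.\<close>

lemma half_colorable_path_graph_ge_2:
  assumes "half_colorable k t (path_graph n)" "n \<ge> 2"
  shows "k \<ge> 2"
proof -
  obtain f where "half_coloring k t (path_graph n) f"
    using assms(1) unfolding half_colorable_def by blast
  then have "f \<in> {0..<n} \<rightarrow> {0..<k}" "f 0 \<noteq> f 1"
    using assms(2) by (auto simp: half_coloring_def path_graph_def)
  moreover from this(1) have "f 0 < k" "f 1 < k"
    using assms(2) by (auto simp: Pi_iff)
  ultimately show ?thesis
    by linarith
qed

lemma half_colorable_path_graph_ge_4: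
  assumes "half_colorable k 1 (path_graph n)" "n \<ge> 3"
  shows "k \<ge> 4"
proof (rule ccontr)
  assume "\<not> k \<ge> 4"
  then have k: "k \<le> 3" by simp
  obtain f where f: "half_coloring k 1 (path_graph n) f"
    using assms(1) unfolding half_colorable_def by blast
  \<comment> \<open>Vertex 1 is the inner vertex to use: \<open>n \<ge> 3\<close> guarantees both
    its neighbours 0 and 2.\<close>
  let ?N = "{v. (1, v) \<in> parcs (path_graph n) \<and> circ_dist k (f 1) (f v) = 1}"
  have lt: "f i < k" if "i < n" for i
    using f that by (auto simp: half_coloring_def path_graph_def Pi_iff)
  have arcs: "(1, 0) \<in> parcs (path_graph n)" "(1, 2) \<in> parcs (path_graph n)"
    using assms(2) by (auto simp: path_graph_def)
  have "f 1 \<noteq> f 0" "f 1 \<noteq> f 2"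
    using f arcs unfolding half_coloring_def by blast+
  then have "{0, 2} \<subseteq> ?N"
    using arcs k lt assms(2) by (auto intro!: circ_dist_eq_1)
  \<comment> \<open>Needed for monotonicity of \<open>card\<close>, which is 0 on infinite
    sets.\<close>
  moreover have "finite ?N"
    by (rule finite_subset[of _ "{..<n}"]) (auto simp: path_graph_def)
  ultimately have "card {0, 2 :: nat} \<le> card ?N"
    by (intro card_mono)
  moreover have "card ?N \<le> 1"
  proof -
    have "1 \<in> pverts (path_graph n)"
      using assms(2) by (simp add: path_graph_def)
    then show ?thesis
      using f unfolding half_coloring_def by blast
  qed
  ultimately show False
    by simp
qed

theorem theorem2p1:
  fixes t n :: nat
  assumes "t > 0" and "n \<ge> 3"
  shows "(t = 1 \<longrightarrow> circ_chromatic2 t (path_graph n) = 4) \<and>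
         (t \<ge> 2 \<longrightarrow> circ_chromatic2 t (path_graph n) = 2)"
proof (intro conjI impI)
  assume "t = 1"
  then show "circ_chromatic2 t (path_graph n) = 4"
    unfolding circ_chromatic2_def
    using half_colorable_path_graph_4 half_colorable_path_graph_ge_4 assms(2)
    by (intro Least_equality) auto
next
  assume "t \<ge> 2"
  then show "circ_chromatic2 t (path_graph n) = 2"
    unfolding circ_chromatic2_def
    using half_colorable_path_graph_2 half_colorable_path_graph_ge_2 assms(2)
    by (intro Least_equality) auto
qed

end
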